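(* Let $\mathsf{X}$ be a shift space over a finite alphabet $\mathcal{A}$, let $a\in\mathcal{A}$, and let $\mathsf{X}'$ be the shift space over $\mathcal{A}\cup\{\ast\}$ (where $\ast\notin\mathcal{A}$) obtained from $\mathsf{X}$ by the symbol expansion $\mathcal{E}$ which inserts $\ast$ after every occurrence of $a$. Let $(E_K(\mathsf{X}),\mathcal{L}_K)$ and $(E_K(\mathsf{X}'),\mathcal{L}_K)$ be the left Krieger covers of $\mathsf{X}$ and $\mathsf{X}'$. Then there is a one-to-one correspondence between the proper communication sets of $E_K(\mathsf{X})$ and those of $E_K(\mathsf{X}')$. Moreover, the proper communication graphs $PC(E_K(\mathsf{X}))$ and $PC(E_K(\mathsf{X}'))$ are isomorphic as directed graphs.
   Context: A shift space $\mathsf{X}$ over a finite alphabet $\mathcal{A}$ is a closed shift-invariant subset of $\mathcal{A}^{\mathbf{Z}}$. $\mathcal{B}(\mathsf{X})$ is its language: the set of finite words (including the empty word) occurring in its elements. Each $x\in\mathsf{X}$ is written $x=x^-x^+$ with left-ray $x^-=\dots x_{-2}x_{-1}$ and right-ray $x^+=x_0x_1x_2\dots$; $\mathsf{X}^-$, $\mathsf{X}^+$ are the sets of all left-rays, right-rays of elements of $\mathsf{X}$. For $x^+\in\mathsf{X}^+$, $P_\infty(x^+)=\{y^-\in\mathsf{X}^- : y^-x^+\in\mathsf{X}\}$. The left Krieger cover $(E_K(\mathsf{X}),\mathcal{L}_K)$ is the labelled directed graph whose vertices are the sets $P_\infty(x^+)$, $x^+\in\mathsf{X}^+$, with an edge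 labelled $b$ from $P_\infty(x^+)$ to $P_\infty(y^+)$ if and only if $by^+\in\mathsf{X}^+$ and $P_\infty(x^+)=P_\infty(by^+)$. Symbol expansion: fix $a\in\mathcal{A}$ and $\ast\notin\mathcal{A}$; $\mathcal{E}$ inserts $\ast$ immediately after every occurrence of $a$. $\mathsf{X}'$ is the shift space over $\mathcal{A}\cup\{\ast\}$ whose language is the set of all subwords of the words $\mathcal{E}(w)$, $w\in\mathcal{B}(\mathsf{X})$. Let $E$ be a directed graph. Write $v\ge w$ if there is a path (possibly of length $0$) from $v$ to $w$. Vertices $v,w$ properly communicate if there are paths of length at least one from $v$ to $w$ and from $w$ to $v$. A proper communication set is a maximal nonempty set of vertices any two (not necessarily distinct) of which properly communicate; i.e. an equivalence class of proper communication on the set of vertices lying on some circuit. The proper communication graph $PC(E)$ is the directed graph whose vertices are the proper communication sets $PC_i$ of $E$, with exactly one edge from $PC_i$ to $PC_j$, for $i\neq j$, if $v\ge w$ for some $v\in PC_i$, $w\in PC_j$, and no other edges. An isomorphism of directed graphs is a pair of bijections on vertices and edges intertwining the source and range maps. *)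

theory Defs
  imports
    "HOL-Analysis.Analysis"
    "HOL-Library.Sublist"
    "Graph_Theory.Digraph_Isomorphism"
begin

section \<open>Shift spaces\<close>

definition shift :: "(int \<Rightarrow> 'a) \<Rightarrow> int \<Rightarrow> 'a" where
  "shift x = (\<lambda>i. x (i + 1))"

text \<open>\<open>closedin\<close> includes that every point is a sequence with entries in \<open>A\<close>.\<close>

definition shift_space :: "'a set \<Rightarrow> (int \<Rightarrow> 'a) set \<Rightarrow> bool" where
  "shift_space A X \<longleftrightarrow>
     finite A \<and>
     closedin (product_topology (\<lambda>_::int. discrete_topology A) UNIV) X \<and>
     shift ` X = X"

definition factor :: "(int \<Rightarrow> 'a) \<Rightarrow> int \<Rightarrow> nat \<Rightarrow> 'a list" where
  "factor x i n = map (\<lambda>k. x (i + int k)) [0..<n]"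

definition language :: "(int \<Rightarrow> 'a) set \<Rightarrow> 'a list set" where
  "language X = {factor x i n | x i n. x \<in> X}"

text \<open>Left-rays are indexed from the right: entry \<open>n\<close> of the left-ray of \<open>x\<close> is \<open>x (- n - 1)\<close>.\<close>

definition left_ray :: "(int \<Rightarrow> 'a) \<Rightarrow> nat \<Rightarrow> 'a" where
  "left_ray x = (\<lambda>n. x (- int n - 1))"

definition right_ray :: "(int \<Rightarrow> 'a) \<Rightarrow> nat \<Rightarrow> 'a" where
  "right_ray x = (\<lambda>n. x (int n))"

definition join_rays :: "(nat \<Rightarrow> 'a) \<Rightarrow> (nat \<Rightarrow> 'a) \<Rightarrow> int \<Rightarrow> 'a" where
  "join_rays l r = (\<lambda>i. if i < 0 then l (nat (- i - 1)) else r (nat i))"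

lemma left_ray_join [simp]: "left_ray (join_rays l r) = l"
  and right_ray_join [simp]: "right_ray (join_rays l r) = r"
  and join_left_right [simp]: "join_rays (left_ray x) (right_ray x) = x"
  by (auto simp: left_ray_def right_ray_def join_rays_def)

definition cons_ray :: "'a \<Rightarrow> (nat \<Rightarrow> 'a) \<Rightarrow> nat \<Rightarrow> 'a" where
  "cons_ray b r = case_nat b r"

definition P_infty :: "(int \<Rightarrow> 'a) set \<Rightarrow> (nat \<Rightarrow> 'a) \<Rightarrow> (nat \<Rightarrow> 'a) set" where
  "P_infty X r = {l \<in> left_ray ` X. join_rays l r \<in> X}"


section \<open>The left Krieger cover\<close>

text \<open>An arc is a triple of source, label and range; the labelling is the middle component.\<close>

definition left_krieger_cover ::
  "(int \<Rightarrow> 'a) set \<Rightarrow> ((nat \<Rightarrow> 'a) set, (nat \<Rightarrow> 'a) set \<times> 'a \<times> (nat \<Rightarrow> 'a) set) pre_digraph" where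
  "left_krieger_cover X =
     \<lparr> verts = P_infty X ` right_ray ` X,
       arcs = {(P_infty X r, b, P_infty X s) | r b s.
                 r \<in> right_ray ` X \<and> s \<in> right_ray ` X \<and>
                 cons_ray b s \<in> right_ray ` X \<and> P_infty X r = P_infty X (cons_ray b s)},
       tail = (\<lambda>(v, b, w). v),
       head = (\<lambda>(v, b, w). w) \<rparr>"


section \<open>Symbol expansion\<close>

definition expand_word :: "'a \<Rightarrow> 'a \<Rightarrow> 'a list \<Rightarrow> 'a list" where
  "expand_word a star w = concat (map (\<lambda>b. if b = a then [a, star] else [b]) w)"

definition symbol_expansion ::
  "'a set \<Rightarrow> 'a \<Rightarrow> 'a \<Rightarrow> (int \<Rightarrow> 'a) set \<Rightarrow> (int \<Rightarrow> 'a) set \<Rightarrow> bool" where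
  "symbol_expansion A a star X X' \<longleftrightarrow>
     shift_space (insert star A) X' \<and>
     language X' = {u. \<exists>w \<in> language X. sublist u (expand_word a star w)}"


section \<open>Proper communication graph\<close>

text \<open>\<open>reachable1\<close> is reachability by a path of length at least one,
  \<open>reachable\<close> by a path of any length.\<close>

definition properly_communicate :: "('v, 'e) pre_digraph \<Rightarrow> 'v \<Rightarrow> 'v \<Rightarrow> bool" where
  "properly_communicate G v w \<longleftrightarrow> reachable1 G v w \<and> reachable1 G w v"

definition mutually_communicating :: "('v, 'e) pre_digraph \<Rightarrow> 'v set \<Rightarrow> bool" where
  "mutually_communicating G C \<longleftrightarrow>
     C \<noteq> {} \<and> C \<subseteq> verts G \<and> (\<forall>v\<in>C. \<forall>w\<in>C. properly_communicate G v w)"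

definition proper_communication_sets :: "('v, 'e) pre_digraph \<Rightarrow> 'v set set" where
  "proper_communication_sets G =
     {C. mutually_communicating G C \<and> (\<forall>D. mutually_communicating G D \<and> C \<subseteq> D \<longrightarrow> D = C)}"

definition proper_communication_graph ::
  "('v, 'e) pre_digraph \<Rightarrow> ('v set, 'v set \<times> 'v set) pre_digraph" where
  "proper_communication_graph G =
     \<lparr> verts = proper_communication_sets G,
       arcs = {(C, D). C \<in> proper_communication_sets G \<and> D \<in> proper_communication_sets G \<and>
                 C \<noteq> D \<and> (\<exists>v\<in>C. \<exists>w\<in>D. reachable G v w)},
       tail = fst,
       head = snd \<rparr>"


section \<open>Well-definedness of the symbol expansion\<close>

lemma length_factor [simp]: "length (factor x i n) = n"
  by (simp add: factor_def)

lemma nth_factor [simp]: "k < n \<Longrightarrow> factor x i n ! k = x (i + int k)"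
  by (simp add: factor_def)

lemma factor_add: "factor x i (m + n) = factor x i m @ factor x (i + int m) n"
  by (rule nth_equalityI) (auto simp: nth_append)

lemma sublist_factor:
  assumes "j \<le> i" "i + int n \<le> j + int m"
  shows "sublist (factor x i n) (factor x j m)"
proof -
  define p where "p = nat (i - j)"
  define q where "q = m - (p + n)"
  have "m = p + (n + q)" "i = j + int p" using assms by (auto simp: p_def q_def)
  then have "factor x j m = factor x j p @ factor x i n @ factor x (i + int n) q"
    by (simp add: factor_add)
  then show ?thesis by (auto simp: sublist_def)
qed

lemma shift_space_translate:
  assumes "shift_space A X" "x \<in> X"
  shows "(\<lambda>i. x (i + k)) \<in> X"
proof -
  have sh: "shift ` X = X" using assms by (simp add: shift_space_def)
  show ?thesis
  proof (induction k rule: int_induct[where k = 0])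
    case base then show ?case using assms by simp
  next
    case (step1 k)
    have "shift (\<lambda>i. x (i + k)) \<in> X" using step1 sh by blast
    then show ?case by (simp add: shift_def algebra_simps)
  next
    case (step2 k)
    then obtain y where y: "y \<in> X" "shift y = (\<lambda>i. x (i + k))" using sh by (metis imageE)
    have "y i = x (i + (k - 1))" for i
      using fun_cong[OF y(2), of "i - 1"] by (simp add: shift_def algebra_simps)
    then have "y = (\<lambda>i. x (i + (k - 1)))" by blast
    then show ?case using y by simp
  qed
qed

lemma shift_space_range: "shift_space A X \<Longrightarrow> x \<in> X \<Longrightarrow> x i \<in> A"
  unfolding shift_space_def by (auto dest!: closedin_subset simp: PiE_iff Pi_iff subset_iff)

lemma closedin_factors:
  "closedin (product_topology (\<lambda>_::int. discrete_topology B) UNIV)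
     {y. range y \<subseteq> B \<and> (\<forall>i n. factor y i n \<in> L)}" (is "closedin ?T ?C")
proof -
  have ts: "topspace ?T = {y. range y \<subseteq> B}" by auto
  have "openin ?T (topspace ?T - ?C)"
  proof (subst openin_subopen, intro ballI)
    fix y assume y: "y \<in> topspace ?T - ?C"
    then obtain i n where *: "factor y i n \<notin> L" and yB: "range y \<subseteq> B" by (auto simp: ts)
    define U where "U = PiE UNIV (\<lambda>k. if i \<le> k \<and> k < i + int n then {y k} else B)"
    have "openin ?T U" unfolding U_def
    proof (rule product_topology_basis)
      show "openin (discrete_topology B) (if i \<le> k \<and> k < i + int n then {y k} else B)" for k
        using yB by auto
      have "{k. (if i \<le> k \<and> k < i + int n then {y k} else B) \<noteq> topspace (discrete_topology B)}
          \<subseteq> {i..<i + int n}" by auto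
      then show "finite {k. (if i \<le> k \<and> k < i + int n then {y k} else B) \<noteq> topspace (discrete_topology B)}"
        by (rule finite_subset) simp
    qed
    moreover have "y \<in> U" using yB by (auto simp: U_def)
    moreover have "U \<subseteq> topspace ?T - ?C"
    proof
      fix z assume z: "z \<in> U"
      have "z k \<in> B" for k
        using z yB unfolding U_def by (auto simp: PiE_iff split: if_splits dest!: spec[of _ k])
      moreover have "z k = y k" if "i \<le> k \<and> k < i + int n" for k
        using z that unfolding U_def by (auto simp: PiE_iff split: if_splits dest!: spec[of _ k])
      then have "factor z i n = factor y i n"
        by (intro nth_equalityI) auto
      ultimately show "z \<in> topspace ?T - ?C" using * by (auto simp: ts) metis
    qed
    ultimately show "\<exists>U. openin ?T U \<and> y \<in> U \<and> U \<subseteq> topspace ?T - ?C" by blast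
  qed
  then show ?thesis by (auto simp: closedin_def)
qed

lemma shift_space_mem_iff:
  assumes "shift_space A X"
  shows "y \<in> X \<longleftrightarrow> range y \<subseteq> A \<and> (\<forall>i n. factor y i n \<in> language X)"
proof
  assume "y \<in> X"
  then show "range y \<subseteq> A \<and> (\<forall>i n. factor y i n \<in> language X)"
    using shift_space_range[OF assms] by (auto simp: language_def)
next
  let ?T = "product_topology (\<lambda>_::int. discrete_topology A) UNIV"
  assume y: "range y \<subseteq> A \<and> (\<forall>i n. factor y i n \<in> language X)"
  show "y \<in> X"
  proof (rule ccontr)
    assume "y \<notin> X"
    have "openin ?T (topspace ?T - X)" using assms by (auto simp: shift_space_def closedin_def)
    moreover have "y \<in> topspace ?T - X" using y \<open>y \<notin> X\<close> by auto
    ultimately obtain U where U: "finite {k. U k \<noteq> A}"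
        "y \<in> PiE UNIV U" "PiE UNIV U \<subseteq> topspace ?T - X"
      unfolding openin_product_topology_alt by auto blast
    define N where "N = (\<Sum>k | U k \<noteq> A. nat \<bar>k\<bar>)"
    have N: "\<bar>k\<bar> \<le> int N" if "U k \<noteq> A" for k
    proof -
      have "nat \<bar>k\<bar> \<le> N" unfolding N_def by (rule member_le_sum) (use that U in auto)
      then show ?thesis by linarith
    qed
    have "factor y (- int N) (2 * N + 1) \<in> language X" using y by blast
    then obtain x i n where x: "x \<in> X" "factor y (- int N) (2 * N + 1) = factor x i n"
      by (auto simp: language_def)
    have n: "n = 2 * N + 1" using arg_cong[OF x(2), of length] by simp
    define z where "z = (\<lambda>k. x (k + (i + int N)))"
    have "z \<in> X" unfolding z_def by (rule shift_space_translate[OF assms x(1)])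
    have "z k = y k" if "\<bar>k\<bar> \<le> int N" for k
    proof -
      define j where "j = nat (k + int N)"
      have j: "j < 2 * N + 1" "k = int j - int N" using that by (auto simp: j_def)
      have "factor y (- int N) (2 * N + 1) ! j = factor x i (2 * N + 1) ! j"
        using x(2) n by simp
      then have "y (- int N + int j) = x (i + int j)" by (simp only: nth_factor[OF j(1)])
      then show ?thesis by (simp add: z_def j(2) algebra_simps)
    qed
    then have "z k \<in> U k" for k
      using N[of k] U(2) shift_space_range[OF assms \<open>z \<in> X\<close>, of k]
      by (cases "U k = A") (auto simp: PiE_iff)
    then have "z \<in> PiE UNIV U" by auto
    then show False using U(3) \<open>z \<in> X\<close> by blast
  qed
qed

lemma expand_word_append: "expand_word a star (u @ v) = expand_word a star u @ expand_word a star v"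
  by (simp add: expand_word_def)

lemma length_expand_word: "length w \<le> length (expand_word a star w)"
  by (induction w) (auto simp: expand_word_def)

lemma set_expand_word: "set (expand_word a star w) \<subseteq> insert star (set w)"
  by (auto simp: expand_word_def)

lemma symbol_expansion_point:
  assumes X: "shift_space A X" and x: "x \<in> X"
  obtains y where "range y \<subseteq> insert star A"
    and "\<And>i n. \<exists>w\<in>language X. sublist (factor y i n) (expand_word a star w)"
    and "\<And>n. factor y 0 (length (expand_word a star (factor x 0 n))) = expand_word a star (factor x 0 n)"
proof -
  let ?e = "expand_word a star"
  define R where "R n = ?e (factor x 0 n)" for n
  define L where "L n = rev (?e (factor x (- int n) n))" for n
  have lR: "n \<le> length (R n)" and lL: "n \<le> length (L n)" for n
    using length_expand_word[of "factor x 0 n" a star]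
      length_expand_word[of "factor x (- int n) n" a star] by (auto simp: R_def L_def)
  have "\<exists>s. R (n + d) = R n @ s" for n d
    by (simp add: R_def factor_add expand_word_append)
  then have R_nth: "R m ! k = R n ! k" if "n \<le> m" "k < length (R n)" for m n k
    using that by (metis le_add_diff_inverse nth_append_left)
  have Ls: "\<exists>s. L (n + d) = L n @ s" for n d
  proof -
    have "factor x (- int (n + d)) (d + n) = factor x (- int (n + d)) d @ factor x (- int n) n"
      by (simp add: factor_add)
    then show ?thesis by (simp add: L_def expand_word_append add.commute)
  qed
  then have L_nth: "L m ! k = L n ! k" if "n \<le> m" "k < length (L n)" for m n k
    using that by (metis le_add_diff_inverse nth_append_left)
  define y where "y = join_rays (\<lambda>k. L (Suc k) ! k) (\<lambda>k. R (Suc k) ! k)"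
  have yR: "y (int k) = R n ! k" if "k < length (R n)" for k n
  proof -
    have "R (Suc k) ! k = R n ! k"
      using R_nth[of n "Suc k" k] R_nth[of "Suc k" n k] lR[of "Suc k"] that
      by (cases "n \<le> Suc k") auto
    then show ?thesis by (simp add: y_def join_rays_def)
  qed
  have yL: "y (- int k - 1) = L n ! k" if "k < length (L n)" for k n
  proof -
    have "L (Suc k) ! k = L n ! k"
      using L_nth[of n "Suc k" k] L_nth[of "Suc k" n k] lL[of "Suc k"] that
      by (cases "n \<le> Suc k") auto
    then show ?thesis by (simp add: y_def join_rays_def)
  qed
  have xA: "set (factor x i n) \<subseteq> A" for i n
    using shift_space_range[OF X x] by (auto simp: factor_def)
  have fR: "factor y 0 (length (R n)) = R n" for n
    by (rule nth_equalityI) (auto simp: yR)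
  have fL: "factor y (- int (length (L n))) (length (L n)) = rev (L n)" for n
  proof (rule nth_equalityI)
    fix k assume k: "k < length (factor y (- int (length (L n))) (length (L n)))"
    let ?j = "length (L n) - Suc k"
    have kl: "k < length (L n)" using k by simp
    have "factor y (- int (length (L n))) (length (L n)) ! k = y (- int (length (L n)) + int k)"
      by (rule nth_factor[OF kl])
    also have "- int (length (L n)) + int k = - int ?j - 1" using kl by linarith
    also have "y (- int ?j - 1) = L n ! ?j" by (rule yL) (use kl in linarith)
    also have "\<dots> = rev (L n) ! k" by (rule rev_nth[OF kl, symmetric])
    finally show "factor y (- int (length (L n))) (length (L n)) ! k = rev (L n) ! k" .
  qed simp
  have full: "factor y (- int (length (L n))) (length (L n) + length (R n)) = ?e (factor x (- int n) (n + n))" for n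
  proof -
    have "factor y (- int (length (L n))) (length (L n) + length (R n)) = rev (L n) @ R n"
      using fL[of n] fR[of n] by (simp add: factor_add)
    also have "\<dots> = ?e (factor x (- int n) n @ factor x 0 n)"
      by (simp add: L_def R_def expand_word_append)
    also have "factor x (- int n) n @ factor x 0 n = factor x (- int n) (n + n)"
      using factor_add[of x "- int n" n n] by simp
    finally show ?thesis .
  qed
  show ?thesis
  proof (rule that)
    show "\<exists>w\<in>language X. sublist (factor y i n) (?e w)" for i n
    proof
      define N where "N = nat \<bar>i\<bar> + n"
      have "sublist (factor y i n) (factor y (- int (length (L N))) (length (L N) + length (R N)))"
        by (rule sublist_factor) (use lL[of N] lR[of N] N_def in linarith)+
      then show "sublist (factor y i n) (?e (factor x (- int N) (N + N)))" by (simp add: full)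
      show "factor x (- int N) (N + N) \<in> language X" using x by (auto simp: language_def)
    qed
    have "y i \<in> insert star A" for i
    proof -
      define N where "N = Suc (nat \<bar>i\<bar>)"
      have "sublist (factor y i 1) (factor y (- int (length (L N))) (length (L N) + length (R N)))"
        by (rule sublist_factor) (use lL[of N] lR[of N] N_def in linarith)+
      then have "set (factor y i 1) \<subseteq> set (?e (factor x (- int N) (N + N)))"
        unfolding full by (rule set_mono_sublist)
      also have "\<dots> \<subseteq> insert star (set (factor x (- int N) (N + N)))" by (rule set_expand_word)
      also have "\<dots> \<subseteq> insert star A" using xA by (intro insert_mono)
      finally have "set (factor y i 1) \<subseteq> insert star A" .
      moreover have "y i \<in> set (factor y i 1)" by (simp add: factor_def)
      ultimately show ?thesis by (rule subsetD)
    qed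
    then show "range y \<subseteq> insert star A" by auto
    show "factor y 0 (length (?e (factor x 0 n))) = ?e (factor x 0 n)" for n
      using fR[of n] by (simp add: R_def)
  qed
qed

theorem ex1_symbol_expansion:
  assumes X: "shift_space A X"
  shows "\<exists>!X'. symbol_expansion A a star X X'"
proof (rule ex_ex1I)
  let ?B = "insert star A"
  define L where "L = {u. \<exists>w \<in> language X. sublist u (expand_word a star w)}"
  define Y where "Y = {y. range y \<subseteq> ?B \<and> (\<forall>i n. factor y i n \<in> L)}"
  have f_shift: "factor (\<lambda>k. y (k + j)) i n = factor y (i + j) n" for y :: "int \<Rightarrow> 'a" and i j n
    by (simp add: factor_def algebra_simps)
  have tr: "(\<lambda>k. y (k + j)) \<in> Y" if "y \<in> Y" for y j
    using that by (auto simp: Y_def f_shift)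
  have "shift ` Y = Y"
  proof
    show "shift ` Y \<subseteq> Y" using tr[of _ 1] by (auto simp: shift_def[abs_def])
    show "Y \<subseteq> shift ` Y"
    proof
      fix y assume "y \<in> Y"
      then have "(\<lambda>k. y (k + -1)) \<in> Y" by (rule tr)
      moreover have "y = shift (\<lambda>k. y (k + -1))" by (simp add: shift_def)
      ultimately show "y \<in> shift ` Y" by blast
    qed
  qed
  moreover have "closedin (product_topology (\<lambda>_::int. discrete_topology ?B) UNIV) Y"
    unfolding Y_def by (rule closedin_factors)
  ultimately have "shift_space ?B Y" using X by (simp add: shift_space_def)
  moreover have "language Y = L"
  proof
    show "language Y \<subseteq> L" by (auto simp: language_def Y_def)
    show "L \<subseteq> language Y"
    proof
      fix u assume "u \<in> L"
      then obtain x i n where x: "x \<in> X" "sublist u (expand_word a star (factor x i n))"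
        by (auto simp: L_def language_def)
      define x' where "x' = (\<lambda>k. x (k + i))"
      have "x' \<in> X" unfolding x'_def by (rule shift_space_translate[OF X x(1)])
      then obtain y where y: "range y \<subseteq> ?B"
          "\<And>i n. \<exists>w\<in>language X. sublist (factor y i n) (expand_word a star w)"
          "\<And>n. factor y 0 (length (expand_word a star (factor x' 0 n))) = expand_word a star (factor x' 0 n)"
        using symbol_expansion_point[OF X] by metis
      have "y \<in> Y" using y by (auto simp: Y_def L_def)
      have "sublist u (factor y 0 (length (expand_word a star (factor x' 0 n))))"
        using x(2) by (simp add: y(3)) (simp add: x'_def f_shift)
      then obtain p s m where "factor y 0 m = p @ u @ s" by (auto simp: sublist_def)
      moreover from this have "m = length p + (length u + length s)"
        by (metis length_append length_factor)
      ultimately have "u = factor y (int (length p)) (length u)"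
        by (simp add: factor_add)
      then show "u \<in> language Y" using \<open>y \<in> Y\<close> unfolding language_def by blast
    qed
  qed
  ultimately show "\<exists>X'. symbol_expansion A a star X X'"
    by (auto simp: symbol_expansion_def L_def)
next
  fix Y Z assume "symbol_expansion A a star X Y" "symbol_expansion A a star X Z"
  then have "shift_space (insert star A) Y" "shift_space (insert star A) Z" "language Y = language Z"
    by (auto simp: symbol_expansion_def)
  then show "Y = Z" using shift_space_mem_iff by blast
qed

end

theory Submission
  imports Defs
begin

text \<open>An unstarred right-ray of \<open>X'\<close> is the expansion of a right-ray \<open>r\<close> of \<open>X\<close>, and its set of
  predecessors is the expansion of \<open>P_infty X r\<close>; this gives a plain vertex for each vertex of the
  cover of \<open>X\<close>. A starred one is \<open>star\<close> followed by the expansion of some \<open>s\<close> for which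
  \<open>cons_ray a s\<close> is a right-ray of \<open>X\<close>, and its predecessor set depends only on
  \<open>P_infty X (cons_ray a s)\<close>. Hence the cover of \<open>X'\<close> arises from that of \<open>X\<close> by subdividing the
  arcs labelled \<open>a\<close>, all those with the same source at a common new vertex. Such a new vertex has a
  single predecessor, so subdividing changes neither reachability between old vertices nor the
  classes of vertices lying on circuits.\<close>

section \<open>Proper communication classes\<close>

text \<open>In a well-formed graph this is the proper communication set of \<open>v\<close> if
  \<open>v\<close> lies on a circuit, and empty otherwise.\<close>

definition communication_class :: "('v, 'e) pre_digraph \<Rightarrow> 'v \<Rightarrow> 'v set" where
  "communication_class G v = {w. properly_communicate G v w}"

lemma properly_communicate_sym: "properly_communicate G v w \<Longrightarrow> properly_communicate G w v"
  by (simp add: properly_communicate_def)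

lemma properly_communicate_trans:
  "properly_communicate G u v \<Longrightarrow> properly_communicate G v w \<Longrightarrow> properly_communicate G u w"
  by (auto simp: properly_communicate_def intro: trancl_trans)

lemma communication_class_eq:
  "properly_communicate G v w \<Longrightarrow> communication_class G v = communication_class G w"
  by (auto simp: communication_class_def
      intro: properly_communicate_trans properly_communicate_sym)

lemma mem_communication_class_self:
  "v \<in> communication_class G v \<longleftrightarrow> reachable1 G v v"
  by (simp add: communication_class_def properly_communicate_def)

lemma communication_class_eq_iff:
  assumes "reachable1 G w w"
  shows "communication_class G v = communication_class G w \<longleftrightarrow> properly_communicate G v w"
proof
  assume "communication_class G v = communication_class G w"
  then have "w \<in> communication_class G v" using assms by (simp add: mem_communication_class_self)
  then show "properly_communicate G v w" by (simp add: communication_class_def)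
qed (rule communication_class_eq)

context wf_digraph
begin

lemma mutually_communicating_class:
  assumes "reachable1 G v v"
  shows "mutually_communicating G (communication_class G v)"
  unfolding mutually_communicating_def
proof (intro conjI ballI)
  show "communication_class G v \<noteq> {}" using assms mem_communication_class_self[of v G] by blast
  show "communication_class G v \<subseteq> verts G"
    using reachable1_in_verts by (auto simp: communication_class_def properly_communicate_def)
  show "properly_communicate G x y"
    if "x \<in> communication_class G v" "y \<in> communication_class G v" for x y
  proof -
    have "properly_communicate G x v" "properly_communicate G v y"
      using that by (auto simp: communication_class_def intro: properly_communicate_sym)
    then show ?thesis by (rule properly_communicate_trans)
  qed
qed

text \<open>By symmetry and transitivity, a mutually communicating set lies in the class of each of
  its members, and that class is itself mutually communicating. So the maximal sets are the classes
  of vertices on circuits.\<close>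

lemma proper_communication_sets_eq:
  "proper_communication_sets G = communication_class G ` {v. reachable1 G v v}"
proof (intro equalityI subsetI)
  fix C assume C: "C \<in> proper_communication_sets G"
  then obtain v where v: "v \<in> C"
    by (auto simp: proper_communication_sets_def mutually_communicating_def)
  then have "C \<subseteq> communication_class G v" "reachable1 G v v"
    using C by (auto simp: proper_communication_sets_def mutually_communicating_def
        communication_class_def properly_communicate_def)
  then show "C \<in> communication_class G ` {v. reachable1 G v v}"
    using C mutually_communicating_class[of v] by (auto simp: proper_communication_sets_def)
next
  fix C assume "C \<in> communication_class G ` {v. reachable1 G v v}"
  then obtain v where v: "reachable1 G v v" "C = communication_class G v" by auto
  have "D = C" if D: "mutually_communicating G D" "C \<subseteq> D" for D
  proof -
    have "v \<in> D" using D v mem_communication_class_self[of v G] by blast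
    then have "D \<subseteq> C" using D v by (auto simp: mutually_communicating_def communication_class_def)
    then show ?thesis using D by blast
  qed
  then show "C \<in> proper_communication_sets G"
    using mutually_communicating_class v by (auto simp: proper_communication_sets_def)
qed

text \<open>Members of one class are joined by paths of positive length, so a path between the
  classes, even one of length \<open>0\<close>, extends to a path of positive length from
  \<open>v\<close> to \<open>w\<close>. Arcs of the proper communication graph can thus be tested on
  representatives.\<close>

lemma communication_class_reachable_iff:
  assumes "reachable1 G v v" "reachable1 G w w"
  shows "(\<exists>x\<in>communication_class G v. \<exists>y\<in>communication_class G w. reachable G x y)
           \<longleftrightarrow> reachable1 G v w"
proof
  assume "\<exists>x\<in>communication_class G v. \<exists>y\<in>communication_class G w. reachable G x y"
  then obtain x y where "reachable1 G v x" "reachable G x y" "reachable1 G y w"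
    by (auto simp: communication_class_def properly_communicate_def)
  then show "reachable1 G v w"
    using reachable1_reachable_trans trancl_trans by metis
next
  assume "reachable1 G v w"
  then show "\<exists>x\<in>communication_class G v. \<exists>y\<in>communication_class G w. reachable G x y"
    using assms mem_communication_class_self reachable1_reachable by metis
qed

end

text \<open>Comparing reachability is enough: \<open>embed\<close> makes the induced map on classes
  well defined and injective, and \<open>dense\<close> makes it surjective. Arcs are not compared,
  since an arc of \<open>G\<close> may become a longer path of \<open>H\<close>.\<close>

lemma communication_correspondence:
  fixes G :: "('v, 'e) pre_digraph" and H :: "('w, 'f) pre_digraph"
  assumes G: "wf_digraph G" and H: "wf_digraph H"
    and embed: "\<And>v w. v \<in> verts G \<Longrightarrow> w \<in> verts G \<Longrightarrow>
                  reachable1 H (\<phi> v) (\<phi> w) \<longleftrightarrow> reachable1 G v w"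
    and dense: "\<And>u. reachable1 H u u \<Longrightarrow> \<exists>v\<in>verts G. properly_communicate H (\<phi> v) u"
  obtains F where "bij_betw F (proper_communication_sets G) (proper_communication_sets H)"
    and "digraph_iso (proper_communication_graph G) (proper_communication_graph H)"
proof -
  interpret G: wf_digraph G by (rule G)
  interpret H: wf_digraph H by (rule H)
  \<comment> \<open>The union avoids a choice of representative; for a class \<open>C\<close> it is
    taken over equal sets, by the fact \<open>F\<close> below.\<close>
  define F where "F C = (\<Union>v\<in>C. communication_class H (\<phi> v))" for C
  let ?P = "{v. reachable1 G v v}"
  have P: "v \<in> verts G" if "reachable1 G v v" for v
    using that G.reachable1_in_verts by blast
  have comm: "properly_communicate H (\<phi> v) (\<phi> w) \<longleftrightarrow> properly_communicate G v w"
    if "v \<in> verts G" "w \<in> verts G" for v w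
    using that by (simp add: properly_communicate_def embed)
  have F: "F (communication_class G v) = communication_class H (\<phi> v)" if "reachable1 G v v" for v
  proof -
    have "communication_class H (\<phi> w) = communication_class H (\<phi> v)"
      if w: "w \<in> communication_class G v" for w
    proof -
      have "properly_communicate G v w" "w \<in> verts G"
        using w G.reachable1_in_verts
        by (auto simp: communication_class_def properly_communicate_def)
      then show ?thesis using comm P[OF \<open>reachable1 G v v\<close>] communication_class_eq by metis
    qed
    moreover have "v \<in> communication_class G v"
      using that by (simp add: mem_communication_class_self)
    ultimately show ?thesis unfolding F_def by blast
  qed
  have inj: "inj_on F (proper_communication_sets G)"
  proof (rule inj_onI)
    fix C D assume "C \<in> proper_communication_sets G" "D \<in> proper_communication_sets G"
      and eq: "F C = F D"
    then obtain v w where v: "reachable1 G v v" "C = communication_class G v"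
      and w: "reachable1 G w w" "D = communication_class G w"
      by (auto simp: G.proper_communication_sets_eq)
    have "properly_communicate H (\<phi> v) (\<phi> w)"
      using eq v w F P embed communication_class_eq_iff by metis
    then show "C = D" using v w comm P communication_class_eq by metis
  qed
  have img: "F ` proper_communication_sets G = proper_communication_sets H"
  proof -
    have "F ` proper_communication_sets G = (\<lambda>v. communication_class H (\<phi> v)) ` ?P"
      unfolding G.proper_communication_sets_eq image_image using F by (intro image_cong) auto
    also have "\<dots> = proper_communication_sets H"
      unfolding H.proper_communication_sets_eq
    proof (intro equalityI subsetI)
      fix C assume "C \<in> (\<lambda>v. communication_class H (\<phi> v)) ` ?P"
      then show "C \<in> communication_class H ` {u. reachable1 H u u}" using embed P by auto
    next
      fix C assume "C \<in> communication_class H ` {u. reachable1 H u u}"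
      then obtain u where u: "reachable1 H u u" "C = communication_class H u" by auto
      then obtain v where v: "v \<in> verts G" "properly_communicate H (\<phi> v) u" using dense by blast
      then have "reachable1 H (\<phi> v) (\<phi> v)"
        by (auto simp: properly_communicate_def intro: trancl_trans)
      then have "reachable1 G v v" using embed v by blast
      then show "C \<in> (\<lambda>v. communication_class H (\<phi> v)) ` ?P"
        using communication_class_eq[OF v(2)] u by (auto intro!: image_eqI)
    qed
    finally show ?thesis .
  qed
  have reach: "(\<exists>x\<in>F C. \<exists>y\<in>F D. reachable H x y) \<longleftrightarrow> (\<exists>x\<in>C. \<exists>y\<in>D. reachable G x y)"
    if CD: "C \<in> proper_communication_sets G" "D \<in> proper_communication_sets G" for C D
  proof -
    obtain v w where v: "reachable1 G v v" "C = communication_class G v"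
      and w: "reachable1 G w w" "D = communication_class G w"
      using CD by (auto simp: G.proper_communication_sets_eq)
    have "reachable1 H (\<phi> v) (\<phi> v)" "reachable1 H (\<phi> w) (\<phi> w)" using embed v w P by auto
    then show ?thesis
      using v w embed P by (simp add: F H.communication_class_reachable_iff
          G.communication_class_reachable_iff)
  qed
  \<comment> \<open>Arcs are pairs of classes, so \<open>F\<close> also determines the map on
    arcs.\<close>
  define h where "h = \<lparr>iso_verts = F, iso_arcs = map_prod F F, iso_head = snd, iso_tail = fst\<rparr>"
  let ?G = "proper_communication_graph G" and ?H = "proper_communication_graph H"
  have "map_prod F F ` arcs ?G = arcs ?H"
  proof (intro equalityI subsetI)
    fix e assume "e \<in> map_prod F F ` arcs ?G"
    then obtain C D where CD: "C \<in> proper_communication_sets G" "D \<in> proper_communication_sets G"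
      "C \<noteq> D" "\<exists>x\<in>C. \<exists>y\<in>D. reachable G x y" and e: "e = (F C, F D)"
      by (auto simp: proper_communication_graph_def)
    have "F C \<noteq> F D" "\<exists>x\<in>F C. \<exists>y\<in>F D. reachable H x y"
      using CD inj reach[OF CD(1,2)] by (auto dest: inj_onD)
    then show "e \<in> arcs ?H"
      using CD(1,2) img unfolding e proper_communication_graph_def by auto
  next
    fix e assume e: "e \<in> arcs ?H"
    obtain C' D' where [simp]: "e = (C', D')" by force
    have "C' \<in> F ` proper_communication_sets G" "D' \<in> F ` proper_communication_sets G"
      using e img by (simp_all add: proper_communication_graph_def)
    then obtain C D where "C \<in> proper_communication_sets G" "C' = F C"
      "D \<in> proper_communication_sets G" "D' = F D" by blast
    then have "(C, D) \<in> arcs ?G" "e = map_prod F F (C, D)"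
      using e reach by (auto simp: proper_communication_graph_def)
    then show "e \<in> map_prod F F ` arcs ?G" by blast
  qed
  then have "?H = app_iso h ?G"
    using img by (simp add: app_iso_def h_def) (simp add: proper_communication_graph_def)
  moreover have "pre_digraph.digraph_isomorphism ?G h"
    unfolding pre_digraph.digraph_isomorphism_def
  proof (intro conjI ballI)
    show "wf_digraph ?G" by unfold_locales (auto simp: proper_communication_graph_def)
    show "inj_on (iso_verts h) (verts ?G)"
      using inj by (simp add: h_def proper_communication_graph_def)
    show "inj_on (iso_arcs h) (arcs ?G)"
      using inj unfolding h_def proper_communication_graph_def inj_on_def by auto
  qed (auto simp: h_def proper_communication_graph_def)
  ultimately have "digraph_iso ?G ?H" unfolding digraph_iso_def by blast
  then show ?thesis using that[of F] inj img by (simp add: bij_betw_def)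
qed

section \<open>Expansion of rays\<close>

text \<open>Left-rays are read from right to left, so on them an occurrence of \<open>a\<close> becomes \<open>star\<close>
  followed by \<open>a\<close>; hence the two symbols replacing \<open>a\<close> are parameters.\<close>

fun expand_ray :: "'a \<Rightarrow> 'a \<Rightarrow> 'a \<Rightarrow> (nat \<Rightarrow> 'a) \<Rightarrow> nat \<Rightarrow> 'a" where
  "expand_ray a p q r 0 = (if r 0 = a then p else r 0)"
| "expand_ray a p q r (Suc n) =
     (if r 0 = a then (case n of 0 \<Rightarrow> q | Suc m \<Rightarrow> expand_ray a p q (\<lambda>k. r (Suc k)) m)
      else expand_ray a p q (\<lambda>k. r (Suc k)) n)"

text \<open>The entry after a \<open>p\<close> is skipped uninspected, so the result is meaningful
  only where \<open>p\<close> really starts a pair.\<close>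

fun contract_ray :: "'a \<Rightarrow> 'a \<Rightarrow> (nat \<Rightarrow> 'a) \<Rightarrow> nat \<Rightarrow> 'a" where
  "contract_ray a p y 0 = (if y 0 = p then a else y 0)"
| "contract_ray a p y (Suc n) =
     contract_ray a p (if y 0 = p then (\<lambda>k. y (Suc (Suc k))) else (\<lambda>k. y (Suc k))) n"

text \<open>The shape of an expanded ray: \<open>p\<close> and \<open>q\<close> occur only as
  adjacent pairs, and the ray does not begin in the middle of one.\<close>

definition paired_ray :: "'a \<Rightarrow> 'a \<Rightarrow> (nat \<Rightarrow> 'a) \<Rightarrow> bool" where
  "paired_ray p q y \<longleftrightarrow> y 0 \<noteq> q \<and> (\<forall>i. y i = p \<longleftrightarrow> y (Suc i) = q)"

lemma paired_ray_tail:
  assumes "paired_ray p q y" "p \<noteq> q"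
  shows "paired_ray p q (if y 0 = p then (\<lambda>k. y (Suc (Suc k))) else (\<lambda>k. y (Suc k)))"
  using assms unfolding paired_ray_def by auto

lemma expand_contract_ray:
  assumes "paired_ray p q y" "p \<noteq> q" "a \<in> {p, q}"
  shows "expand_ray a p q (contract_ray a p y) = y"
proof
  fix n
  show "expand_ray a p q (contract_ray a p y) n = y n"
    using assms(1)
  proof (induction n arbitrary: y rule: less_induct)
    case (less n)
    note tail = paired_ray_tail[OF less.prems assms(2)]
    \<comment> \<open>A first entry other than \<open>p\<close> is not \<open>q\<close> either,
      since the ray does not begin inside a pair; so it is not \<open>a\<close>, and expansion keeps
      it.\<close>
    have ya: "y 0 \<noteq> a" if "y 0 \<noteq> p" using that assms(3) less.prems by (auto simp: paired_ray_def)
    show ?case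
    proof (cases n)
      case 0
      then show ?thesis using ya by auto
    next
      case (Suc m)
      show ?thesis
      proof (cases "y 0 = p")
        case True
        then have "y (Suc 0) = q" using less.prems by (auto simp: paired_ray_def)
        then show ?thesis
          using True Suc less.IH[of "m - 1" "\<lambda>k. y (Suc (Suc k))"] tail by (auto split: nat.split)
      next
        case False
        then show ?thesis using Suc ya less.IH[of m "\<lambda>k. y (Suc k)"] tail by auto
      qed
    qed
  qed
qed

text \<open>An entry \<open>p\<close> of \<open>r\<close> different from \<open>a\<close> would be
  mistaken by \<open>contract_ray\<close> for the start of a pair. On right-rays \<open>p\<close> is
  \<open>a\<close>; on left-rays \<open>p\<close> is \<open>star\<close>, which is absent from rays
  over \<open>A\<close>.\<close>

lemma contract_expand_ray:
  assumes "p = a \<or> p \<notin> range r"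
  shows "contract_ray a p (expand_ray a p q r) = r"
proof
  fix n
  show "contract_ray a p (expand_ray a p q r) n = r n"
    using assms
  proof (induction n arbitrary: r)
    case 0
    then show ?case by auto
  next
    case (Suc n)
    have IH: "contract_ray a p (expand_ray a p q (\<lambda>k. r (Suc k))) n = r (Suc n)"
      using Suc.IH[of "\<lambda>k. r (Suc k)"] Suc.prems by auto
    have "r 0 = p \<Longrightarrow> r 0 = a" using Suc.prems by auto
    then show ?case using IH by auto
  qed
qed

lemma contract_ray_range:
  assumes "paired_ray p q y" "p \<noteq> q"
  shows "contract_ray a p y n \<in> insert a (range y - {p, q})"
  using assms(1)
proof (induction n arbitrary: y)
  case 0
  then show ?case by (auto simp: paired_ray_def)
next
  case (Suc n)
  show ?case using Suc.IH[OF paired_ray_tail[OF Suc.prems assms(2)]] by (auto split: if_splits)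
qed

lemma expand_ray_range: "expand_ray a p q r n \<in> range r \<union> {p, q}"
proof (induction n arbitrary: r rule: less_induct)
  case (less n)
  have tail: "expand_ray a p q (\<lambda>k. r (Suc k)) m \<in> range r \<union> {p, q}" if "m < n" for m
    using less.IH[OF that, of "\<lambda>k. r (Suc k)"] by blast
  show ?case
  proof (cases n)
    case 0
    then show ?thesis by simp
  next
    case (Suc m)
    then have "r 0 = a \<Longrightarrow> m = Suc i \<Longrightarrow> expand_ray a p q r n \<in> range r \<union> {p, q}" for i
      using tail[of i] by simp
    moreover have "r 0 = a \<Longrightarrow> m = 0 \<Longrightarrow> expand_ray a p q r n \<in> range r \<union> {p, q}"
      using Suc by simp
    moreover have "r 0 \<noteq> a \<Longrightarrow> expand_ray a p q r n \<in> range r \<union> {p, q}"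
      using Suc tail[of m] by simp
    ultimately show ?thesis by (cases m) blast+
  qed
qed

lemma expand_cons_ray:
  "expand_ray a p q (cons_ray b r) =
     (if b = a then cons_ray p (cons_ray q (expand_ray a p q r))
      else cons_ray b (expand_ray a p q r))"
proof
  fix n show "expand_ray a p q (cons_ray b r) n = 
     (if b = a then cons_ray p (cons_ray q (expand_ray a p q r))
      else cons_ray b (expand_ray a p q r)) n"
    by (cases n) (auto simp: cons_ray_def split: nat.split)
qed

section \<open>Expansion of words and of finite windows\<close>

definition expand_list :: "'a \<Rightarrow> 'a \<Rightarrow> 'a \<Rightarrow> 'a list \<Rightarrow> 'a list" where
  "expand_list a p q w = concat (map (\<lambda>b. if b = a then [p, q] else [b]) w)"

lemma expand_word_eq_expand_list: "expand_word a star = expand_list a a star"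
  by (simp add: expand_word_def expand_list_def fun_eq_iff)

text \<open>Relates the left half of a window, which is stored backwards, to
  \<open>expand_word\<close>.\<close>

lemma rev_expand_list: "rev (expand_list a p q w) = expand_list a q p (rev w)"
  by (induction w) (auto simp: expand_list_def)

lemma length_expand_list: "length w \<le> length (expand_list a p q w)"
  by (induction w) (auto simp: expand_list_def)

text \<open>Ties the recursion on rays to the word expansion by which \<open>X'\<close> is
  given.\<close>

lemma expand_ray_prefix:
  "map (expand_ray a p q r) [0..<length (expand_list a p q (map r [0..<n]))]
     = expand_list a p q (map r [0..<n])"
proof (induction n arbitrary: r)
  case 0
  then show ?case by (simp add: expand_list_def)
next
  case (Suc n)
  have split: "expand_list a p q (b # w) = (if b = a then [p, q] else [b]) @ expand_list a p q w" for b w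
    by (simp add: expand_list_def)
  show ?case
    using Suc.IH[of "\<lambda>k. r (Suc k)"]
    by (auto simp: map_upt_Suc split simp del: upt_Suc)
qed

lemma factor_join_rays:
  "factor (join_rays l r) (- int m) (m + n) = rev (map l [0..<m]) @ map r [0..<n]"
  by (rule nth_equalityI)
    (auto simp: nth_append rev_nth join_rays_def nat_diff_distrib' intro!: arg_cong[where f = l]
      arg_cong[where f = r])

text \<open>The witnesses are \<open>n\<close> plus the number of occurrences of \<open>a\<close> in
  the left and the right half of the window. As they are at least \<open>n\<close>, the expanded
  windows exhaust the whole sequence.\<close>

lemma factor_join_expand_rays:
  obtains M N where "n \<le> M" "n \<le> N"
    and "factor (join_rays (expand_ray a star a l) (expand_ray a a star r)) (- int M) (M + N)
           = expand_word a star (factor (join_rays l r) (- int n) (n + n))"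
proof
  let ?M = "length (expand_list a star a (map l [0..<n]))"
  let ?N = "length (expand_list a a star (map r [0..<n]))"
  show "n \<le> ?M" "n \<le> ?N"
    using length_expand_list[of "map l [0..<n]"] length_expand_list[of "map r [0..<n]"] by auto
  show "factor (join_rays (expand_ray a star a l) (expand_ray a a star r)) (- int ?M) (?M + ?N)
          = expand_word a star (factor (join_rays l r) (- int n) (n + n))"
    by (simp add: factor_join_rays expand_ray_prefix rev_expand_list expand_word_eq_expand_list
        expand_word_append[unfolded expand_word_eq_expand_list])
qed

text \<open>Deleting \<open>star\<close> undoes expansion, so a subword relation between expansions
  can be pulled back to the original words.\<close>

lemma filter_expand_word: "star \<notin> set w \<Longrightarrow> filter (\<lambda>b. b \<noteq> star) (expand_word a star w) = w"
  by (induction w) (auto simp: expand_word_def)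

lemma sublist_filter: "sublist u v \<Longrightarrow> sublist (filter P u) (filter P v)"
  unfolding sublist_def by (metis filter_append)

lemma expand_word_pairs:
  assumes "star \<notin> set w" "sublist [c, d] (expand_word a star w)"
  shows "c = a \<longleftrightarrow> d = star"
  using assms
proof (induction w)
  case Nil
  then show ?case by (simp add: expand_word_def)
next
  case (Cons b w)
  \<comment> \<open>A pair across the boundary of two blocks begins with the last symbol of the
    first block, which is \<open>star\<close> or differs from \<open>a\<close>, and ends with the
    first symbol of the next block, which is never \<open>star\<close>.\<close>
  have nostar: "\<not> prefix [star] (expand_word a star w)"
    using Cons.prems(1) by (cases w) (auto simp: expand_word_def)
  have *: "expand_word a star (b # w) = (if b = a then [a, star] else [b]) @ expand_word a star w"
    by (simp add: expand_word_def)
  show ?case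
    using Cons nostar unfolding * by (auto simp: sublist_Cons_right split: if_splits)
qed

lemma language_sublist:
  assumes "w \<in> language X" "sublist u w"
  shows "u \<in> language X"
proof -
  obtain x i m where x: "x \<in> X" "w = factor x i m" using assms by (auto simp: language_def)
  obtain p s where w: "w = p @ u @ s" using assms by (auto simp: sublist_def)
  then have "m = length p + (length u + length s)" using x by (metis length_append length_factor)
  then have "u = factor x (i + int (length p)) (length u)" using x w by (simp add: factor_add)
  then show ?thesis using x unfolding language_def by blast
qed

lemma factor_in_language: "x \<in> X \<Longrightarrow> factor x i n \<in> language X"
  by (auto simp: language_def)

lemma shift_space_shift_iff:
  assumes "shift_space B Y"
  shows "(\<lambda>i. y (i + k)) \<in> Y \<longleftrightarrow> y \<in> Y"
  using shift_space_translate[OF assms, of y k]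
    shift_space_translate[OF assms, of "\<lambda>i. y (i + k)" "- k"] by auto

text \<open>The same sequence with the origin on either side of \<open>b\<close>.\<close>

lemma join_cons_ray: "join_rays (cons_ray b l) r = (\<lambda>i. join_rays l (cons_ray b r) (i + 1))"
proof
  fix i :: int
  consider "i \<ge> 0" | "i = -1" | "i < -1" by linarith
  then show "join_rays (cons_ray b l) r i = join_rays l (cons_ray b r) (i + 1)"
  proof cases
    case 1
    then have "nat (i + 1) = Suc (nat i)" by simp
    then show ?thesis using 1 by (simp add: join_rays_def cons_ray_def)
  next
    case 2
    then show ?thesis by (simp add: join_rays_def cons_ray_def)
  next
    case 3
    then have "nat (- i - 1) = Suc (nat (- (i + 1) - 1))" by simp
    then show ?thesis using 3 by (simp add: join_rays_def cons_ray_def)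
  qed
qed

lemma join_cons_ray_iff:
  assumes "shift_space B Y"
  shows "join_rays (cons_ray b l) r \<in> Y \<longleftrightarrow> join_rays l (cons_ray b r) \<in> Y"
  unfolding join_cons_ray by (rule shift_space_shift_iff[OF assms])

lemma P_infty_eq: "P_infty X r = {l. join_rays l r \<in> X}"
proof -
  have "l \<in> left_ray ` X" if "join_rays l r \<in> X" for l
    using imageI[OF that, of left_ray] by simp
  then show ?thesis unfolding P_infty_def by blast
qed

lemma right_ray_image_iff: "r \<in> right_ray ` X \<longleftrightarrow> (\<exists>l. join_rays l r \<in> X)"
proof
  assume "r \<in> right_ray ` X"
  then obtain x where "x \<in> X" "r = right_ray x" by blast
  then show "\<exists>l. join_rays l r \<in> X" by (intro exI[of _ "left_ray x"]) simp
next
  assume "\<exists>l. join_rays l r \<in> X"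
  then obtain l where "join_rays l r \<in> X" ..
  from imageI[OF this, of right_ray] show "r \<in> right_ray ` X" by simp
qed

lemma right_ray_tail:
  assumes "shift_space B Y" "cons_ray b r \<in> right_ray ` Y"
  shows "r \<in> right_ray ` Y"
  using assms(2) join_cons_ray_iff[OF assms(1), of b _ r] unfolding right_ray_image_iff by blast

lemma cons_ray_eq_iff [simp]: "cons_ray b r = cons_ray c s \<longleftrightarrow> b = c \<and> r = s"
  unfolding cons_ray_def fun_eq_iff by (auto split: nat.splits)

lemma cons_ray_0 [simp]: "cons_ray b r 0 = b"
  by (simp add: cons_ray_def)

lemma cons_ray_hd_tl: "cons_ray (r 0) (\<lambda>n. r (Suc n)) = r"
  by (auto simp: cons_ray_def fun_eq_iff split: nat.split)

section \<open>The cover of the expanded shift space\<close>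

lemma wf_left_krieger_cover: "wf_digraph (left_krieger_cover X)"
  by unfold_locales (auto simp: left_krieger_cover_def)

text \<open>The source of an arc is represented by \<open>cons_ray b s\<close> itself; labels are
  dropped because only reachability matters later.\<close>

lemma arcs_ends_left_krieger_cover:
  assumes "shift_space B Y"
  shows "arcs_ends (left_krieger_cover Y)
           = {(P_infty Y (cons_ray b s), P_infty Y s) | b s. cons_ray b s \<in> right_ray ` Y}"
    (is "?L = ?R")
proof (intro equalityI subsetI)
  fix e assume "e \<in> ?L"
  then show "e \<in> ?R" by (auto simp: arcs_ends_conv left_krieger_cover_def)
next
  fix e assume "e \<in> ?R"
  then obtain b s where e: "e = (P_infty Y (cons_ray b s), P_infty Y s)"
    and bs: "cons_ray b s \<in> right_ray ` Y" by blast
  then have "(P_infty Y (cons_ray b s), b, P_infty Y s) \<in> arcs (left_krieger_cover Y)"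
    using right_ray_tail[OF assms bs] unfolding left_krieger_cover_def by auto
  from imageI[OF this, of "\<lambda>e. (tail (left_krieger_cover Y) e, head (left_krieger_cover Y) e)"]
  show "e \<in> ?L" unfolding arcs_ends_conv e by (simp add: left_krieger_cover_def)
qed

section \<open>Points of the expanded shift space\<close>

locale expanded_shift_space =
  fixes A :: "'a set" and a star :: 'a and X X' :: "(int \<Rightarrow> 'a) set"
  assumes X: "shift_space A X" and aA: "a \<in> A" and star: "star \<notin> A"
    and expansion: "symbol_expansion A a star X X'"
begin

abbreviation expand_left :: "(nat \<Rightarrow> 'a) \<Rightarrow> nat \<Rightarrow> 'a" where
  "expand_left \<equiv> expand_ray a star a"

abbreviation expand_right :: "(nat \<Rightarrow> 'a) \<Rightarrow> nat \<Rightarrow> 'a" where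
  "expand_right \<equiv> expand_ray a a star"

lemma X': "shift_space (insert star A) X'"
  using expansion by (simp add: symbol_expansion_def)

lemma a_neq_star: "a \<noteq> star"
  using aA star by blast

lemma language_X': "language X' = {u. \<exists>w\<in>language X. sublist u (expand_word a star w)}"
  using expansion by (simp add: symbol_expansion_def)

lemma language_alphabet: "w \<in> language X \<Longrightarrow> set w \<subseteq> A"
  using shift_space_range[OF X] by (auto simp: language_def factor_def)

lemma join_range:
  assumes "join_rays l r \<in> X"
  shows "range l \<subseteq> A" "range r \<subseteq> A"
proof -
  have "join_rays l r (- int n - 1) \<in> A" "join_rays l r (int n) \<in> A" for n
    using shift_space_range[OF X assms] by auto
  then show "range l \<subseteq> A" "range r \<subseteq> A" by (auto simp: join_rays_def)
qed

text \<open>Both spaces are determined by their languages, so it suffices to compare central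
  windows: expansion carries windows of one sequence to windows of the other, and deleting
  \<open>star\<close> recovers a subword of some word of \<open>X\<close>.\<close>

lemma join_expand_mem_iff:
  assumes "range l \<subseteq> A" "range r \<subseteq> A"
  shows "join_rays (expand_left l) (expand_right r) \<in> X' \<longleftrightarrow> join_rays l r \<in> X"
proof
  let ?x = "join_rays l r" and ?y = "join_rays (expand_left l) (expand_right r)"
  have x: "range ?x \<subseteq> A" using assms by (auto simp: join_rays_def)
  assume y: "?y \<in> X'"
  have "factor ?x i n \<in> language X" for i n
  proof -
    \<comment> \<open>Large enough for the window from \<open>- N\<close> to \<open>N\<close> to
      contain the given factor.\<close>
    define N where "N = nat \<bar>i\<bar> + n"
    let ?w = "factor ?x (- int N) (N + N)"
    have "expand_word a star ?w \<in> language X'"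
      using factor_join_expand_rays[of N a star l r] factor_in_language[OF y] by metis
    then obtain w where w: "w \<in> language X" "sublist (expand_word a star ?w) (expand_word a star w)"
      unfolding language_X' by blast
    have "star \<notin> set ?w" using x star by (auto simp: factor_def)
    moreover have "star \<notin> set w" using language_alphabet[OF w(1)] star by blast
    ultimately have "sublist ?w w"
      using sublist_filter[OF w(2), of "\<lambda>b. b \<noteq> star"] by (simp add: filter_expand_word)
    then have "?w \<in> language X" using w(1) language_sublist by blast
    moreover have "sublist (factor ?x i n) ?w"
      by (rule sublist_factor) (use N_def in linarith)+
    ultimately show ?thesis using language_sublist by blast
  qed
  then show "?x \<in> X" using x by (simp add: shift_space_mem_iff[OF X])
next
  let ?x = "join_rays l r" and ?y = "join_rays (expand_left l) (expand_right r)"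
  assume x: "?x \<in> X"
  have "expand_left l n \<in> insert star A" "expand_right r n \<in> insert star A" for n
    using expand_ray_range[of a star a l n] expand_ray_range[of a a star r n] assms aA by auto
  then have "range ?y \<subseteq> insert star A" by (auto simp: join_rays_def)
  moreover have "factor ?y i n \<in> language X'" for i n
  proof -
    define K where "K = nat \<bar>i\<bar> + n"
    obtain M N where MN: "K \<le> M" "K \<le> N"
      "factor ?y (- int M) (M + N) = expand_word a star (factor ?x (- int K) (K + K))"
      by (rule factor_join_expand_rays)
    have "sublist (factor ?y i n) (factor ?y (- int M) (M + N))"
      by (rule sublist_factor) (use MN(1,2) K_def in linarith)+
    then show ?thesis
      unfolding MN(3) language_X' using factor_in_language[OF x] by blast
  qed
  ultimately show "?y \<in> X'" by (simp add: shift_space_mem_iff[OF X'])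
qed

lemma X'_pairs:
  assumes "y \<in> X'"
  shows "y i = a \<longleftrightarrow> y (i + 1) = star"
proof -
  have "factor y i 2 \<in> language X'" using assms by (rule factor_in_language)
  moreover have "factor y i 2 = [y i, y (i + 1)]" by (simp add: factor_def numeral_2_eq_2)
  ultimately obtain w where "w \<in> language X" "sublist [y i, y (i + 1)] (expand_word a star w)"
    unfolding language_X' by auto
  then show ?thesis using expand_word_pairs language_alphabet star by (metis subsetD)
qed

text \<open>The condition on \<open>y 0\<close> says that the origin does not cut a pair, so both
  rays of \<open>y\<close> are paired and contracting them gives the preimage.\<close>

lemma X'_cases:
  assumes y: "y \<in> X'" and y0: "y 0 \<noteq> star"
  obtains l r where "join_rays l r \<in> X" "y = join_rays (expand_left l) (expand_right r)"
proof -
  have yA: "y i \<in> insert star A" for i using shift_space_range[OF X' y] .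
  have R: "paired_ray a star (right_ray y)"
    unfolding paired_ray_def right_ray_def
    using y0 X'_pairs[OF y] by (auto simp: add.commute)
  have L: "paired_ray star a (left_ray y)"
    unfolding paired_ray_def
  proof (intro conjI allI)
    show "left_ray y 0 \<noteq> a" using y0 X'_pairs[OF y, of "-1"] by (simp add: left_ray_def)
    show "left_ray y i = star \<longleftrightarrow> left_ray y (Suc i) = a" for i
    proof -
      \<comment> \<open>Entries \<open>i\<close> and \<open>i + 1\<close> of the left-ray are at
        positions \<open>- i - 1\<close> and \<open>- i - 2\<close>; read from left to right, the
        pair starts at \<open>- i - 2\<close>.\<close>
      have "- int i - 2 + 1 = - int i - 1" "- int (Suc i) - 1 = - int i - 2" by simp_all
      then show ?thesis using X'_pairs[OF y, of "- int i - 2"] unfolding left_ray_def by metis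
    qed
  qed
  let ?l = "contract_ray a star (left_ray y)" and ?r = "contract_ray a a (right_ray y)"
  have "?l n \<in> A" "?r n \<in> A" for n
    using contract_ray_range[OF L, of a n] contract_ray_range[OF R, of a n] yA aA a_neq_star
    by (auto simp: left_ray_def right_ray_def) (metis insertE)+
  then have ranges: "range ?l \<subseteq> A" "range ?r \<subseteq> A" by auto
  have eq: "y = join_rays (expand_left ?l) (expand_right ?r)"
    using expand_contract_ray[OF L, of a] expand_contract_ray[OF R, of a] a_neq_star by simp
  then have "join_rays ?l ?r \<in> X" using y join_expand_mem_iff[OF ranges] by simp
  then show ?thesis using that eq by blast
qed

lemma expand_left_inj: "inj_on expand_left {l. range l \<subseteq> A}"
  by (rule inj_on_inverseI[of _ "contract_ray a star"], rule contract_expand_ray) (use star in blast)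

lemma expand_right_inj: "inj expand_right"
  by (rule inj_on_inverseI[of _ "contract_ray a a"]) (simp add: contract_expand_ray)

text \<open>The expanded ray does not begin with \<open>star\<close>, so every point of
  \<open>X'\<close> with this right-ray is an expansion, and injectivity of
  \<open>expand_right\<close> identifies its right half with \<open>r\<close>.\<close>

lemma P_infty_expand_right:
  assumes "range r \<subseteq> A"
  shows "P_infty X' (expand_right r) = expand_left ` P_infty X r"
proof (intro equalityI subsetI)
  fix l' assume "l' \<in> P_infty X' (expand_right r)"
  then have y: "join_rays l' (expand_right r) \<in> X'" by (simp add: P_infty_eq)
  have "r 0 \<noteq> star" using assms star by blast
  then have "join_rays l' (expand_right r) 0 \<noteq> star" using a_neq_star by (simp add: join_rays_def)
  from X'_cases[OF y this] obtain l s where ls: "join_rays l s \<in> X"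
    and eq: "join_rays l' (expand_right r) = join_rays (expand_left l) (expand_right s)" .
  have "l' = expand_left l" "expand_right r = expand_right s"
    using arg_cong[OF eq, of left_ray] arg_cong[OF eq, of right_ray] by simp_all
  then show "l' \<in> expand_left ` P_infty X r"
    using ls injD[OF expand_right_inj] by (auto simp: P_infty_eq)
next
  fix l' assume "l' \<in> expand_left ` P_infty X r"
  then show "l' \<in> P_infty X' (expand_right r)"
    using join_expand_mem_iff join_range by (auto simp: P_infty_eq)
qed

text \<open>A leading \<open>star\<close> must be preceded by \<open>a\<close>. Moving the origin
  across this \<open>a\<close> gives the expansion of \<open>cons_ray a s\<close> and reduces to the
  unstarred case.\<close>

lemma P_infty_star:
  assumes "range s \<subseteq> A"
  shows "P_infty X' (cons_ray star (expand_right s))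
           = cons_ray a ` expand_left ` P_infty X (cons_ray a s)"
proof -
  have "range (cons_ray a s) \<subseteq> A" using assms aA by (auto simp: cons_ray_def subset_iff split: nat.split)
  note P = P_infty_expand_right[OF this]
  have iff: "cons_ray a l \<in> P_infty X' (cons_ray star (expand_right s))
      \<longleftrightarrow> l \<in> P_infty X' (expand_right (cons_ray a s))" for l
    by (simp add: P_infty_eq expand_cons_ray join_cons_ray_iff[OF X'])
  have "\<exists>l. l' = cons_ray a l" if "l' \<in> P_infty X' (cons_ray star (expand_right s))" for l'
  proof -
    have "join_rays l' (cons_ray star (expand_right s)) \<in> X'" using that by (simp add: P_infty_eq)
    from X'_pairs[OF this, of "-1"] have "l' 0 = a" by (simp add: join_rays_def)
    then show ?thesis using cons_ray_hd_tl by metis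
  qed
  then show ?thesis using iff unfolding P by blast
qed

text \<open>A ray is a right-ray of a space exactly when its predecessor set is nonempty, and
  expansion preserves nonemptiness.\<close>

lemma right_ray_expand_iff:
  assumes "range r \<subseteq> A"
  shows "expand_right r \<in> right_ray ` X' \<longleftrightarrow> r \<in> right_ray ` X"
  using P_infty_expand_right[OF assms] by (auto simp: right_ray_image_iff P_infty_eq)

lemma right_ray_range: "r \<in> right_ray ` X \<Longrightarrow> range r \<subseteq> A"
  using join_range(2) by (auto simp: right_ray_image_iff)

text \<open>In the starred case the symbol before \<open>y\<close> is forced to be \<open>a\<close>;
  then \<open>cons_ray a y\<close> is unstarred, hence the expansion of a ray beginning with
  \<open>a\<close>.\<close>

lemma right_ray_X'_cases:
  assumes "y \<in> right_ray ` X'"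
  obtains (plain) r where "r \<in> right_ray ` X" "y = expand_right r"
    | (star) s where "cons_ray a s \<in> right_ray ` X" "y = cons_ray star (expand_right s)"
proof -
  have plain: "\<exists>r. r \<in> right_ray ` X \<and> z = expand_right r" if z: "z \<in> right_ray ` X'" "z 0 \<noteq> star" for z
  proof -
    obtain l where l: "join_rays l z \<in> X'" using z right_ray_image_iff by metis
    have "join_rays l z 0 \<noteq> star" using z by (simp add: join_rays_def)
    from X'_cases[OF l this] obtain l' r where "join_rays l' r \<in> X"
      and eq: "join_rays l z = join_rays (expand_left l') (expand_right r)" .
    moreover have "z = expand_right r" using arg_cong[OF eq, of right_ray] by simp
    ultimately show ?thesis using right_ray_image_iff by metis
  qed
  show ?thesis
  proof (cases "y 0 = star")
    case False
    then show ?thesis using plain[OF assms] that(1) by blast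
  next
    case True
    obtain l where l: "join_rays l y \<in> X'" using assms right_ray_image_iff by metis
    from X'_pairs[OF l, of "-1"] have "l 0 = a" using True by (simp add: join_rays_def)
    then have "cons_ray a (\<lambda>n. l (Suc n)) = l" using cons_ray_hd_tl by metis
    then have "cons_ray a y \<in> right_ray ` X'"
      using l join_cons_ray_iff[OF X'] right_ray_image_iff by metis
    then obtain r where r: "r \<in> right_ray ` X" "cons_ray a y = expand_right r"
      using plain[of "cons_ray a y"] a_neq_star by auto
    define s where "s = (\<lambda>n. r (Suc n))"
    have rs: "r = cons_ray (r 0) s" by (simp add: s_def cons_ray_hd_tl)
    have "r 0 = a" using r(2) by (subst (asm) rs) (auto simp: expand_cons_ray split: if_splits)
    then have "y = cons_ray star (expand_right s)"
      using r(2) by (subst (asm) rs) (simp add: expand_cons_ray)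
    then show ?thesis using that(2) r(1) rs \<open>r 0 = a\<close> by metis
  qed
qed

section \<open>Plain and star vertices\<close>

definition plain_vertex :: "(nat \<Rightarrow> 'a) set \<Rightarrow> (nat \<Rightarrow> 'a) set" where
  "plain_vertex V = expand_left ` V"

text \<open>In use, \<open>V\<close> is the predecessor set of \<open>cons_ray a s\<close>, the
  source of the subdivided arcs, rather than that of \<open>s\<close>.\<close>

definition star_vertex :: "(nat \<Rightarrow> 'a) set \<Rightarrow> (nat \<Rightarrow> 'a) set" where
  "star_vertex V = cons_ray a ` expand_left ` V"

abbreviation "cover \<equiv> left_krieger_cover X"
abbreviation "cover' \<equiv> left_krieger_cover X'"

lemma verts_coverD:
  assumes "v \<in> verts cover"
  shows "v \<noteq> {}" "v \<subseteq> {l. range l \<subseteq> A}"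
proof -
  obtain r where "r \<in> right_ray ` X" "v = P_infty X r"
    using assms by (auto simp: left_krieger_cover_def)
  then show "v \<noteq> {}" "v \<subseteq> {l. range l \<subseteq> A}"
    using join_range(1) by (auto simp: right_ray_image_iff P_infty_eq)
qed

lemma P_infty_in_verts: "r \<in> right_ray ` X \<Longrightarrow> P_infty X r \<in> verts cover"
  by (simp add: left_krieger_cover_def)

lemma plain_vertex_eq_iff:
  "v \<in> verts cover \<Longrightarrow> w \<in> verts cover \<Longrightarrow> plain_vertex v = plain_vertex w \<longleftrightarrow> v = w"
  unfolding plain_vertex_def
  by (rule inj_on_image_eq_iff[OF expand_left_inj]) (simp_all add: verts_coverD)

lemma star_vertex_eq_iff:
  assumes "v \<in> verts cover" "w \<in> verts cover"
  shows "star_vertex v = star_vertex w \<longleftrightarrow> v = w"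
proof -
  have "inj (cons_ray a)" by (rule injI) simp
  then show ?thesis
    using plain_vertex_eq_iff[OF assms]
    unfolding star_vertex_def plain_vertex_def by (simp add: inj_image_eq_iff)
qed

text \<open>A left-ray that can precede an unstarred right-ray never ends in \<open>a\<close>.\<close>

lemma plain_vertex_neq_star_vertex:
  assumes "v \<in> verts cover"
  shows "plain_vertex v \<noteq> star_vertex w"
proof
  assume eq: "plain_vertex v = star_vertex w"
  obtain l where l: "l \<in> v" using verts_coverD[OF assms] by blast
  then have "expand_left l \<in> star_vertex w" using eq by (auto simp: plain_vertex_def)
  then obtain l' where "expand_left l = cons_ray a l'" by (auto simp: star_vertex_def)
  from fun_cong[OF this, of 0] show False using a_neq_star by (auto split: if_splits)
qed

lemma P_infty_plain:
  "r \<in> right_ray ` X \<Longrightarrow> P_infty X' (expand_right r) = plain_vertex (P_infty X r)"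
  using P_infty_expand_right right_ray_range by (simp add: plain_vertex_def)

lemma P_infty_starred:
  assumes "cons_ray a s \<in> right_ray ` X"
  shows "P_infty X' (cons_ray star (expand_right s)) = star_vertex (P_infty X (cons_ray a s))"
  using P_infty_star right_ray_range right_ray_tail[OF X assms] by (simp add: star_vertex_def)

section \<open>Arcs of the expanded cover\<close>

lemma arcs_ends_cover: "arcs_ends cover
    = {(P_infty X (cons_ray b s), P_infty X s) | b s. cons_ray b s \<in> right_ray ` X}"
  by (rule arcs_ends_left_krieger_cover[OF X])

lemma arcs_ends_cover':
  "arcs_ends cover' = {(P_infty X' (cons_ray b y), P_infty X' y) | b y. cons_ray b y \<in> right_ray ` X'}"
  by (rule arcs_ends_left_krieger_cover[OF X'])

lemma arc_plain:
  assumes "cons_ray b s \<in> right_ray ` X" "b \<noteq> a"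
  shows "(plain_vertex (P_infty X (cons_ray b s)), plain_vertex (P_infty X s)) \<in> arcs_ends cover'"
proof -
  have e: "expand_right (cons_ray b s) = cons_ray b (expand_right s)"
    using assms by (simp add: expand_cons_ray)
  then have "cons_ray b (expand_right s) \<in> right_ray ` X'"
    using assms right_ray_expand_iff right_ray_range by metis
  then show ?thesis
    using P_infty_plain[OF assms(1)] P_infty_plain[OF right_ray_tail[OF X assms(1)]]
    unfolding arcs_ends_cover' e by blast
qed

text \<open>The expansion of \<open>cons_ray a s\<close> starts with \<open>a\<close> and
  \<open>star\<close>; removing these one at a time gives the two arcs.\<close>

lemma arc_to_and_from_star:
  assumes "cons_ray a s \<in> right_ray ` X"
  shows "(plain_vertex (P_infty X (cons_ray a s)), star_vertex (P_infty X (cons_ray a s))) \<in> arcs_ends cover'"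
    and "(star_vertex (P_infty X (cons_ray a s)), plain_vertex (P_infty X s)) \<in> arcs_ends cover'"
proof -
  have e: "expand_right (cons_ray a s) = cons_ray a (cons_ray star (expand_right s))"
    by (simp add: expand_cons_ray)
  then have R: "cons_ray a (cons_ray star (expand_right s)) \<in> right_ray ` X'"
    using assms right_ray_expand_iff right_ray_range by metis
  then show "(plain_vertex (P_infty X (cons_ray a s)), star_vertex (P_infty X (cons_ray a s))) \<in> arcs_ends cover'"
    using P_infty_plain[OF assms] P_infty_starred[OF assms] unfolding arcs_ends_cover' e by blast
  show "(star_vertex (P_infty X (cons_ray a s)), plain_vertex (P_infty X s)) \<in> arcs_ends cover'"
    using right_ray_tail[OF X' R] P_infty_starred[OF assms]
      P_infty_plain[OF right_ray_tail[OF X assms]] unfolding arcs_ends_cover' by blast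
qed

text \<open>The first symbol of the right-ray at the source decides the case: \<open>star\<close>
  for \<open>from_star\<close>, \<open>a\<close> for \<open>to_star\<close>, any other for
  \<open>plain\<close>.\<close>

lemma arc_cover'_cases:
  assumes "(u, u') \<in> arcs_ends cover'"
  obtains (plain) v w where "(v, w) \<in> arcs_ends cover" "u = plain_vertex v" "u' = plain_vertex w"
    | (to_star) v where "v \<in> verts cover" "u = plain_vertex v" "u' = star_vertex v"
    | (from_star) v w where "(v, w) \<in> arcs_ends cover" "u = star_vertex v" "u' = plain_vertex w"
proof -
  obtain b y where by': "cons_ray b y \<in> right_ray ` X'"
    and u: "u = P_infty X' (cons_ray b y)" "u' = P_infty X' y"
    using assms unfolding arcs_ends_cover' by blast
  have arc: "(P_infty X (cons_ray c s), P_infty X s) \<in> arcs_ends cover"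
    if "cons_ray c s \<in> right_ray ` X" for c s
    using that unfolding arcs_ends_cover by blast
  from by' show ?thesis
  proof (cases rule: right_ray_X'_cases)
    case (star s)
    then have "y = expand_right s" by simp
    then show ?thesis
      using from_star arc[OF star(1)] u star P_infty_starred P_infty_plain right_ray_tail[OF X star(1)]
      by simp
  next
    case (plain r)
    define s where "s = (\<lambda>n. r (Suc n))"
    have rs: "r = cons_ray (r 0) s" by (simp add: s_def cons_ray_hd_tl)
    then have R: "cons_ray (r 0) s \<in> right_ray ` X" using plain(1) by simp
    have e: "cons_ray b y = (if r 0 = a then cons_ray a (cons_ray star (expand_right s))
        else cons_ray (r 0) (expand_right s))"
      using plain(2) rs expand_cons_ray by metis
    have u1: "u = plain_vertex (P_infty X (cons_ray (r 0) s))"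
      using u(1) plain P_infty_plain rs by simp
    show ?thesis
    proof (cases "r 0 = a")
      case True
      then have "y = cons_ray star (expand_right s)" using e by simp
      then have "u' = star_vertex (P_infty X (cons_ray (r 0) s))"
        using u(2) P_infty_starred R True by simp
      then show ?thesis using to_star u1 P_infty_in_verts[OF R] by blast
    next
      case False
      then have "y = expand_right s" using e by simp
      then have "u' = plain_vertex (P_infty X s)"
        using u(2) P_infty_plain right_ray_tail[OF X R] by simp
      then show ?thesis using that(1) u1 arc[OF R] by blast
    qed
  qed
qed

section \<open>Paths and circuits\<close>

lemma arc_cover_plain_path:
  assumes "(v, w) \<in> arcs_ends cover"
  shows "reachable1 cover' (plain_vertex v) (plain_vertex w)"
proof -
  obtain b s where bs: "cons_ray b s \<in> right_ray ` X"
    "v = P_infty X (cons_ray b s)" "w = P_infty X s"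
    using assms unfolding arcs_ends_cover by blast
  show ?thesis
  proof (cases "b = a")
    case True
    \<comment> \<open>An arc labelled \<open>a\<close> becomes a path of length two through the star
      vertex of \<open>v\<close>.\<close>
    then show ?thesis
      using arc_to_and_from_star[of s] bs by (auto intro: trancl_into_trancl)
  next
    case False
    then show ?thesis using arc_plain bs by auto
  qed
qed

lemma arc_cover_in_verts:
  assumes "(v, w) \<in> arcs_ends cover"
  shows "v \<in> verts cover" "w \<in> verts cover"
  using wf_digraph.adj_in_verts[OF wf_left_krieger_cover assms] by auto

text \<open>The second alternative carries the induction: \<open>star_vertex w\<close> is entered
  only from \<open>plain_vertex w\<close>, halfway along an arc leaving \<open>w\<close>, so the
  path in \<open>cover\<close> may still have length \<open>0\<close> there; the step out of it adds
  an arc.\<close>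

lemma path_from_plain_vertex:
  assumes "reachable1 cover' (plain_vertex v) u" "v \<in> verts cover"
  shows "(\<exists>w\<in>verts cover. u = plain_vertex w \<and> reachable1 cover v w)
       \<or> (\<exists>w\<in>verts cover. u = star_vertex w \<and> (v, w) \<in> (arcs_ends cover)\<^sup>*)"
  using assms(1)
proof (induction rule: trancl_induct)
  case (base u)
  then show ?case
  proof (cases rule: arc_cover'_cases)
    case (plain v' w)
    then have "v' = v" "w \<in> verts cover" using plain_vertex_eq_iff arc_cover_in_verts assms(2) by metis+
    then show ?thesis using plain by blast
  next
    case (to_star v')
    then have "v' = v" using plain_vertex_eq_iff assms(2) by metis
    then show ?thesis using to_star by blast
  next
    case (from_star v' w)
    then show ?thesis using plain_vertex_neq_star_vertex assms(2) by blast
  qed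
next
  case (step u u')
  from step(3) show ?case
  proof (elim disjE bexE conjE)
    fix x assume x: "x \<in> verts cover" "u = plain_vertex x" "reachable1 cover v x"
    from step(2) show ?thesis
    proof (cases rule: arc_cover'_cases)
      case (plain v' w)
      then have "v' = x" "w \<in> verts cover" using plain_vertex_eq_iff arc_cover_in_verts x by metis+
      then show ?thesis using plain x trancl_into_trancl[of v x] by blast
    next
      case (to_star v')
      then have "v' = x" using plain_vertex_eq_iff x by metis
      then show ?thesis using to_star x trancl_into_rtrancl[of v x] by blast
    next
      case (from_star v' w)
      then show ?thesis using plain_vertex_neq_star_vertex x by blast
    qed
  next
    fix x assume x: "x \<in> verts cover" "u = star_vertex x" "(v, x) \<in> (arcs_ends cover)\<^sup>*"
    from step(2) show ?thesis
    proof (cases rule: arc_cover'_cases)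
      case (plain v' w)
      then show ?thesis using plain_vertex_neq_star_vertex[of v' x] arc_cover_in_verts x by metis
    next
      case (to_star v')
      then show ?thesis using plain_vertex_neq_star_vertex[of v' x] x by metis
    next
      case (from_star v' w)
      then have "v' = x" "w \<in> verts cover" using star_vertex_eq_iff arc_cover_in_verts x by metis+
      then show ?thesis using from_star x rtrancl_into_trancl1[of v x] by blast
    qed
  qed
qed

lemma reachable1_plain_iff:
  assumes "v \<in> verts cover" "w \<in> verts cover"
  shows "reachable1 cover' (plain_vertex v) (plain_vertex w) \<longleftrightarrow> reachable1 cover v w"
proof
  assume "reachable1 cover' (plain_vertex v) (plain_vertex w)"
  from path_from_plain_vertex[OF this assms(1)] show "reachable1 cover v w"
    using plain_vertex_eq_iff plain_vertex_neq_star_vertex assms by metis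
next
  assume "reachable1 cover v w"
  then show "reachable1 cover' (plain_vertex v) (plain_vertex w)"
  proof (induction rule: trancl_induct)
    case (base w)
    then show ?case by (rule arc_cover_plain_path)
  next
    case (step x y)
    then show ?case using arc_cover_plain_path trancl_trans by metis
  qed
qed

text \<open>The only arc into a star vertex comes from the corresponding plain vertex, so every circuit
  passes through a plain vertex.\<close>

lemma circuit_meets_plain_vertex:
  assumes "reachable1 cover' u u"
  shows "\<exists>v\<in>verts cover. properly_communicate cover' (plain_vertex v) u"
proof -
  obtain z where z: "(u, z) \<in> (arcs_ends cover')\<^sup>*" "(z, u) \<in> arcs_ends cover'"
    using tranclD2[OF assms] by blast
  from z(2) show ?thesis
  proof (cases rule: arc_cover'_cases)
    case (plain v w)
    then show ?thesis using assms arc_cover_in_verts by (auto simp: properly_communicate_def)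
  next
    case (from_star v w)
    then show ?thesis using assms arc_cover_in_verts by (auto simp: properly_communicate_def)
  next
    case (to_star v)
    \<comment> \<open>Here \<open>u\<close> is a star vertex and \<open>z\<close> is plain, so the
      path from \<open>u\<close> to \<open>z\<close> is not empty.\<close>
    then have "u \<noteq> z" using plain_vertex_neq_star_vertex by metis
    then have "reachable1 cover' u z" using z(1) by (auto simp: rtrancl_eq_or_trancl)
    then show ?thesis using to_star z(2) by (auto simp: properly_communicate_def)
  qed
qed

end

theorem proposition3p9:
  fixes A :: "'a set" and X X' :: "(int \<Rightarrow> 'a) set" and a star :: 'a
  assumes "shift_space A X"
    and "a \<in> A"
    and "star \<notin> A"
    and "symbol_expansion A a star X X'"
  shows "(\<exists>f. bij_betw f (proper_communication_sets (left_krieger_cover X))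
                         (proper_communication_sets (left_krieger_cover X'))) \<and>
         digraph_iso (proper_communication_graph (left_krieger_cover X))
                     (proper_communication_graph (left_krieger_cover X'))"
proof -
  interpret expanded_shift_space A a star X X' using assms by unfold_locales
  \<comment> \<open>The transfer is applied with \<open>plain_vertex\<close> as the vertex
    map.\<close>
  show ?thesis
    by (rule communication_correspondence[OF wf_left_krieger_cover wf_left_krieger_cover
          reachable1_plain_iff circuit_meets_plain_vertex]) blast+
qed

end
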